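(* Let $d\ge 1$ and let $C_1, C_2\colon [0,1]\to\mathbb{R}^d$ be either two convex curves or two closed convex curves, and suppose that $C_1$ and $C_2$ have opposite orientations (one positive, the other negative). Then there exists an affine hyperplane $H\subset\mathbb{R}^d$ such that for every $t\in[0,1]$ the points $C_1(t)$ and $C_2(t)$ are not both contained in the same open halfspace bounded by $H$.
   Context: A convex curve in $\mathbb{R}^d$ is a continuous map $C\colon[0,1]\to\mathbb{R}^d$ such that $|\{t\in[0,1] : C(t)\in H\}|\le d$ for every affine hyperplane $H\subset\mathbb{R}^d$. A closed convex curve in $\mathbb{R}^d$ is a continuous map $C\colon[0,1]\to\mathbb{R}^d$ with $C(0)=C(1)$ such that $|\{t\in[0,1) : C(t)\in H\}|\le d$ for every affine hyperplane $H\subset\mathbb{R}^d$. Orientation: for a convex curve $C$, the determinant $$\det\begin{bmatrix} C(t_0) & C(t_1) & \cdots & C(t_d)\\ 1 & 1 & \cdots & 1\end{bmatrix}$$ is non-zero and has the same sign for all $0\le t_0<t_1<\dots<t_d\le 1$; for a closed convex curve the same holds for all $0\le t_0<t_1<\dots<t_d<1$. The orientation of $C$ is called positive or negative according to this common sign. *)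

theory Defs
  imports "HOL-Analysis.Analysis"
begin

text \<open>
  The space \<open>\<real>\<^sup>d\<close> is \<open>real ^ 'n\<close> with \<open>d = CARD('n)\<close>, so \<open>d \<ge> 1\<close> holds automatically. The index type
  is linearly ordered because the sign of the orientation determinant depends on the order of
  the coordinates.
\<close>

definition hyperplane :: "(real ^ 'n) set \<Rightarrow> bool" where
  "hyperplane H \<longleftrightarrow> (\<exists>a b. a \<noteq> 0 \<and> H = {x. a \<bullet> x = b})"

text \<open>Both sides of \<open>H\<close> qualify, as \<open>(a, b)\<close> may be replaced by \<open>(- a, - b)\<close>.\<close>

definition open_halfspace_of :: "(real ^ 'n) set \<Rightarrow> (real ^ 'n) set \<Rightarrow> bool" where
  "open_halfspace_of H S \<longleftrightarrow> (\<exists>a b. a \<noteq> 0 \<and> H = {x. a \<bullet> x = b} \<and> S = {x. a \<bullet> x < b})"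

text \<open>Finiteness is required explicitly because \<open>card\<close> is \<open>0\<close> on infinite sets.\<close>

definition convex_curve :: "(real \<Rightarrow> real ^ 'n) \<Rightarrow> bool" where
  "convex_curve C \<longleftrightarrow> continuous_on {0..1} C \<and>
     (\<forall>H. hyperplane H \<longrightarrow>
        finite {t \<in> {0..1}. C t \<in> H} \<and> card {t \<in> {0..1}. C t \<in> H} \<le> CARD('n))"

definition closed_convex_curve :: "(real \<Rightarrow> real ^ 'n) \<Rightarrow> bool" where
  "closed_convex_curve C \<longleftrightarrow> continuous_on {0..1} C \<and> C 0 = C 1 \<and>
     (\<forall>H. hyperplane H \<longrightarrow>
        finite {t \<in> {0..<1}. C t \<in> H} \<and> card {t \<in> {0..<1}. C t \<in> H} \<le> CARD('n))"

text \<open>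
  The type \<open>'n option\<close> indexes the rows and columns of \<open>(d + 1) \<times> (d + 1)\<close> matrices, ordered as
  \<open>'n\<close> followed by \<open>None\<close>; \<open>position\<close> is the resulting bijection onto \<open>{0..d}\<close>. Thus row \<open>None\<close> of
  \<open>orientation_matrix\<close> is the last one, and column \<open>j\<close> is \<open>(C (t\<^sub>p), 1)\<close> with \<open>p = position j\<close>.
\<close>

definition position :: "('n::{finite,linorder}) option \<Rightarrow> nat" where
  "position j = (case j of Some k \<Rightarrow> card {..<k} | None \<Rightarrow> CARD('n))"

definition orientation_matrix ::
    "(real \<Rightarrow> real ^ ('n::{finite,linorder})) \<Rightarrow> (nat \<Rightarrow> real) \<Rightarrow> real ^ ('n option) ^ ('n option)" where
  "orientation_matrix C t =
     (\<chi> i j. case i of Some k \<Rightarrow> C (t (position j)) $ k | None \<Rightarrow> 1)"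

text \<open>
  The parameter set \<open>I\<close> is \<open>{0..1}\<close> for convex curves and \<open>{0..<1}\<close> for closed convex curves.
\<close>

definition positively_oriented_on ::
    "real set \<Rightarrow> (real \<Rightarrow> real ^ ('n::{finite,linorder})) \<Rightarrow> bool" where
  "positively_oriented_on I C \<longleftrightarrow>
     (\<forall>t. strict_mono_on {0..CARD('n)} t \<and> t ` {0..CARD('n)} \<subseteq> I \<longrightarrow>
        det (orientation_matrix C t) > 0)"

definition negatively_oriented_on ::
    "real set \<Rightarrow> (real \<Rightarrow> real ^ ('n::{finite,linorder})) \<Rightarrow> bool" where
  "negatively_oriented_on I C \<longleftrightarrow>
     (\<forall>t. strict_mono_on {0..CARD('n)} t \<and> t ` {0..CARD('n)} \<subseteq> I \<longrightarrow>
        det (orientation_matrix C t) < 0)"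

definition opposite_orientations_on ::
    "real set \<Rightarrow> (real \<Rightarrow> real ^ ('n::{finite,linorder})) \<Rightarrow>
     (real \<Rightarrow> real ^ ('n::{finite,linorder})) \<Rightarrow> bool" where
  "opposite_orientations_on I C1 C2 \<longleftrightarrow>
     (positively_oriented_on I C1 \<and> negatively_oriented_on I C2) \<or>
     (negatively_oriented_on I C1 \<and> positively_oriented_on I C2)"

end

theory Submission
  imports Defs "HOL-Homology.Homology"
begin

text \<open>
  With \<open>A\<^sub>t = (C\<^sub>1(t), 1)\<close> and \<open>B\<^sub>t = (C\<^sub>2(t), 1)\<close>, the task is to find a unit vector \<open>v\<close> with
  \<open>Q\<^sub>t(v) = (A\<^sub>t \<bullet> v) (B\<^sub>t \<bullet> v) \<le> 0\<close> for all \<open>t\<close>; by compactness of the sphere, finitely many \<open>t\<close>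
  suffice. For positive weights \<open>c\<close> the matrix \<open>M(c) = \<Sum>\<^sub>t c\<^sub>t A\<^sub>t B\<^sub>t\<^sup>T\<close> has negative determinant, by the
  Cauchy-Binet formula and the opposite orientations. If no such \<open>v\<close> existed, weights \<open>c(v)\<close>
  concentrated on \<open>Q\<^sub>t(v) > 0\<close> would give \<open>v \<bullet> M(c(v)) v > 0\<close>, so that \<open>v \<mapsto> M(c(v)) v\<close>, as a
  nowhere vanishing map on the sphere, is homotopic to the identity. Deforming all weights to \<open>1\<close>
  makes it homotopic to the linear map \<open>M(1)\<close> as well, hence to a reflection, which has degree \<open>-1\<close>.
\<close>

section \<open>Reflections and path components of the general linear group\<close>

text \<open>The matrix of the reflection in the hyperplane orthogonal to \<open>u\<close>. Dividing
  by \<open>u \<bullet> u\<close> spares normalizing \<open>u\<close>, so the normal vector can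
  later be moved along a segment.\<close>

definition householder :: "real^'m \<Rightarrow> real^'m^'m" where
  "householder u = (\<chi> i j. of_bool (i = j) - 2 * u$i * u$j / (u \<bullet> u))"

lemma householder_mult_self:
  assumes "u \<noteq> 0"
  shows "householder u ** householder u = mat 1"
proof -
  have *: "(\<Sum>k\<in>UNIV. (of_bool (i = k) - 2 * u$i * u$k / (u \<bullet> u)) * (of_bool (k = j) - 2 * u$k * u$j / (u \<bullet> u)))
      = (of_bool (i = j) :: real)" for i j
  proof -
    have "(\<Sum>k\<in>UNIV. (of_bool (i = k) - 2 * u$i * u$k / (u \<bullet> u)) * (of_bool (k = j) - 2 * u$k * u$j / (u \<bullet> u)))
      = (\<Sum>k\<in>UNIV. (if i = k then of_bool (k = j) - 2 * u$k * u$j / (u \<bullet> u) else 0)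
            - (if k = j then 2 * u$i * u$k / (u \<bullet> u) else 0)
            + 4 * u$i * u$j / (u \<bullet> u)^2 * (u$k * u$k))"
      by (intro sum.cong refl) (auto simp: algebra_simps power2_eq_square)
    also have "\<dots> = of_bool (i = j) - 2 * u$i * u$j / (u \<bullet> u) - 2 * u$i * u$j / (u \<bullet> u)
            + 4 * u$i * u$j / (u \<bullet> u)^2 * (u \<bullet> u)"
      by (simp add: sum.distrib sum_subtractf sum_distrib_left inner_vec_def sum_divide_distrib)
    also have "\<dots> = of_bool (i = j)"
      using assms by (simp add: power2_eq_square)
    finally show ?thesis .
  qed
  show ?thesis
    unfolding householder_def matrix_matrix_mult_def vec_eq_iff by (simp add: * mat_def)
qed

lemma det_householder_nonzero:
  assumes "u \<noteq> 0"
  shows "det (householder u) \<noteq> 0"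
proof
  assume "det (householder u) = 0"
  then have "det (householder u ** householder u) = 0"
    by (simp add: det_mul)
  with householder_mult_self [OF assms] show False
    by simp
qed

abbreviation gl_connected :: "real^'m^'m \<Rightarrow> real^'m^'m \<Rightarrow> bool" where
  "gl_connected \<equiv> path_component {X. det X \<noteq> 0}"

lemma gl_connectedI:
  fixes g :: "real \<Rightarrow> real^'m^'m"
  assumes "\<And>i j. continuous_on {0..1} (\<lambda>t. g t $ i $ j)"
    and "\<And>t. t \<in> {0..1} \<Longrightarrow> det (g t) \<noteq> 0" "g 0 = A" "g 1 = B"
  shows "gl_connected A B"
proof -
  have "continuous_on {0..1} (\<lambda>t. \<chi> i j. g t $ i $ j)"
    by (intro continuous_on_vec_lambda assms)
  then have "continuous_on {0..1} g"
    by simp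
  with assms show ?thesis
    unfolding path_component_def path_def path_image_def pathstart_def pathfinish_def
    by (intro exI [of _ g]) auto
qed

lemma gl_connectedE:
  fixes A B :: "real^'m^'m"
  assumes "gl_connected A B"
  obtains g :: "real \<Rightarrow> real^'m^'m"
  where "continuous_on {0..1} g" "\<And>t. t \<in> {0..1} \<Longrightarrow> det (g t) \<noteq> 0" "g 0 = A" "g 1 = B"
  using assms unfolding path_component_def path_def path_image_def pathstart_def pathfinish_def
  by (auto simp: image_subset_iff)

lemma gl_connected_mult:
  fixes X A Y B :: "real^'m^'m"
  assumes "gl_connected X A" "gl_connected Y B"
  shows "gl_connected (X ** Y) (A ** B)"
proof -
  obtain g :: "real \<Rightarrow> real^'m^'m" where g: "continuous_on {0..1} g" "\<And>t. t \<in> {0..1} \<Longrightarrow> det (g t) \<noteq> 0" "g 0 = X" "g 1 = A"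
    by (rule gl_connectedE [OF assms(1)]) (rule that)
  obtain h :: "real \<Rightarrow> real^'m^'m" where h: "continuous_on {0..1} h" "\<And>t. t \<in> {0..1} \<Longrightarrow> det (h t) \<noteq> 0" "h 0 = Y" "h 1 = B"
    by (rule gl_connectedE [OF assms(2)]) (rule that)
  show ?thesis
  proof (rule gl_connectedI)
    show "continuous_on {0..1} (\<lambda>t. (g t ** h t) $ i $ j)" for i j
      unfolding matrix_matrix_mult_def vec_lambda_beta
      by (intro continuous_intros g h)
    show "det (g t ** h t) \<noteq> 0" if "t \<in> {0..1}" for t
      using g(2) h(2) that by (simp add: det_mul)
  qed (use g h in auto)
qed

text \<open>Moving the normal vector straight from \<open>u\<close> to \<open>w\<close> gives a path
  of reflections, defined as long as the normal vector does not vanish.\<close>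

lemma gl_connected_householder:
  assumes "0 \<notin> closed_segment u w"
  shows "gl_connected (householder u) (householder w)"
proof (rule gl_connectedI)
  have nz: "(1 - t) *\<^sub>R u + t *\<^sub>R w \<noteq> 0" if "t \<in> {0..1}" for t
    using assms that by (force simp: closed_segment_def)
  show "det (householder ((1 - t) *\<^sub>R u + t *\<^sub>R w)) \<noteq> 0" if "t \<in> {0..1}" for t
    using det_householder_nonzero nz that by blast
  show "continuous_on {0..1} (\<lambda>t. householder ((1 - t) *\<^sub>R u + t *\<^sub>R w) $ i $ j)" for i j
    unfolding householder_def vec_lambda_beta
    by (intro continuous_intros) (use nz in auto)
qed auto

lemma det_diagonal_matrix:
  "det (\<chi> i j. if i = j then c i else 0 :: real^'m^'m) = (\<Prod>i\<in>UNIV. c i)"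
  by (subst det_diagonal) auto

lemma gl_connected_diagonal:
  fixes c d :: "'m::finite \<Rightarrow> real"
  assumes "\<And>i. 0 < c i * d i"
  shows "gl_connected (\<chi> i j. if i = j then c i else 0) (\<chi> i j. if i = j then d i else 0)"
proof (rule gl_connectedI)
  fix t :: real
  assume t: "t \<in> {0..1}"
  have "(1 - t) * c i + t * d i \<noteq> 0" for i
  proof -
    \<comment> \<open>Multiplication by \<open>c i\<close> treats both possible signs of the entry
      at once.\<close>
    have "0 < (1 - t) * (c i * c i) + t * (c i * d i)" 
    proof (cases "t = 0")
      case False
      with t assms [of i] have "0 < t * (c i * d i)" "0 \<le> (1 - t) * (c i * c i)"
        by auto
      then show ?thesis by linarith
    qed (use assms [of i] in \<open>auto simp: zero_less_mult_iff\<close>)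
    also have "\<dots> = c i * ((1 - t) * c i + t * d i)"
      by (simp add: algebra_simps)
    finally show ?thesis
      by auto
  qed
  then show "det (\<chi> i j. if i = j then (1 - t) * c i + t * d i else 0 :: real^'m^'m) \<noteq> 0"
    by (simp add: det_diagonal_matrix)
next
  show "continuous_on {0..1} (\<lambda>t. (\<chi> i j. if i = j then (1 - t) * c i + t * d i else 0 :: real^'m^'m) $ i $ j)"
    for i j
    by (cases "i = j") (auto intro!: continuous_intros)
qed (auto simp: vec_eq_iff)

lemma householder_axis:
  "householder (axis k 1) = (\<chi> i j. if i = j then (if i = k then -1 else 1) else 0)"
  by (simp add: householder_def inner_axis_axis vec_eq_iff) (simp add: axis_def)

text \<open>In a positive coordinate of \<open>u\<close>, both \<open>axis k 1\<close> and
  \<open>u\<close> are nonnegative, so a convex combination can vanish there only if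
  \<open>u\<close> has weight zero; but then it equals \<open>axis k 1\<close>, which is not
  zero.\<close>

lemma gl_connected_householder_axis:
  fixes u :: "real^'m"
  assumes "\<exists>i. u $ i > 0"
  shows "gl_connected (householder (axis k 1)) (householder u)"
proof (rule gl_connected_householder)
  obtain i where i: "u $ i > 0"
    using assms by blast
  show "0 \<notin> closed_segment (axis k 1) u"
  proof
    assume "0 \<in> closed_segment (axis k 1) u"
    then obtain t where t: "0 \<le> t" "t \<le> 1" "0 = (1 - t) *\<^sub>R axis k 1 + t *\<^sub>R u"
      unfolding closed_segment_def by blast
    from arg_cong [OF t(3), of "\<lambda>v. v $ i"]
    have eq: "0 = (1 - t) * (if i = k then 1 else 0) + t * u $ i"
      by (simp add: axis_def)
    have "0 \<le> (1 - t) * (if i = k then 1 else 0 :: real)" "0 \<le> t * u $ i"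
      using t i by auto
    with eq have "t * u $ i = 0" by linarith
    with i have "t = 0" by simp
    with t(3) show False by simp
  qed
qed

text \<open>Being connected to the identity or to a fixed reflection is preserved by products, since
  the reflection is an involution. It remains to check the elementary matrices, of which every
  matrix is a product.\<close>

lemma gl_connected_dichotomy:
  fixes A :: "real^'m^'m"
  assumes "det A \<noteq> 0"
  shows "gl_connected (mat 1) A \<or> gl_connected (householder (axis k 1)) A"
proof -
  let ?R = "householder (axis k 1) :: real^'m^'m"
  have one: "gl_connected (mat 1) (mat 1 :: real^'m^'m)"
    by (simp add: path_component_refl)
  have RR: "?R ** ?R = mat 1"
    by (intro householder_mult_self) (simp add: axis_eq_0_iff)
  \<comment> \<open>The guard \<open>det A \<noteq> 0\<close> admits the singular factors that occur
    in the induction over elementary matrices.\<close>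
  let ?P = "\<lambda>A. det A \<noteq> 0 \<longrightarrow> gl_connected (mat 1) A \<or> gl_connected ?R A"
  have mult: "?P (A ** B)" if "?P A" "?P B" for A B :: "real^'m^'m"
    using that gl_connected_mult [of "mat 1" A "mat 1" B] gl_connected_mult [of "mat 1" A ?R B]
      gl_connected_mult [of ?R A "mat 1" B] gl_connected_mult [of ?R A ?R B] RR
    by (auto simp: det_mul)
  define D where "D c = (\<chi> i j. if i = j then c i else 0 :: real^'m^'m)" for c
  \<comment> \<open>A positive \<open>c\<close> is moved linearly to 1. A negative \<open>c\<close>
    is moved to -1, which gives the reflection along axis \<open>i\<close>; its normal vector is
    then turned to axis \<open>k\<close>.\<close>
  have single: "?P (D (\<lambda>j. if j = i then c else 1))" if "c \<noteq> 0" for i c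
  proof (cases "c > 0")
    case True
    have "gl_connected (D (\<lambda>_. 1)) (D (\<lambda>j. if j = i then c else 1))"
      unfolding D_def by (rule gl_connected_diagonal) (use True in auto)
    moreover have "D (\<lambda>_. 1) = mat 1"
      by (simp add: D_def mat_def)
    ultimately show ?thesis by simp
  next
    case False
    have "gl_connected ?R (householder (axis i 1))"
      by (rule gl_connected_householder_axis) (auto intro!: exI [of _ i])
    also have "gl_connected (householder (axis i 1)) (D (\<lambda>j. if j = i then c else 1))"
      unfolding D_def householder_axis by (rule gl_connected_diagonal) (use False that in auto)
    finally (path_component_trans) show ?thesis by simp
  qed
  have prod: "D c ** D d = D (\<lambda>i. c i * d i)" for c d
    by (auto simp: D_def matrix_matrix_mult_def vec_eq_iff if_distrib [of "\<lambda>x. x * y" for y] cong: if_cong)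
  have diag: "?P (D (\<lambda>i. if i \<in> S then c i else 1))" if "\<And>i. c i \<noteq> 0" for c S
    using finite [of S]
  proof (induction S rule: finite_induct)
    case empty
    then show ?case
      using one by (simp add: D_def mat_def)
  next
    case (insert i S)
    have "D (\<lambda>j. if j = i then c i else 1) ** D (\<lambda>j. if j \<in> S then c j else 1)
        = D (\<lambda>j. if j \<in> insert i S then c j else 1)"
      unfolding prod by (rule arg_cong [of _ _ D]) (use insert.hyps in auto)
    moreover have "?P (D (\<lambda>j. if j = i then c i else 1) ** D (\<lambda>j. if j \<in> S then c j else 1))"
      by (rule mult [OF single [OF that] insert.IH])
    ultimately show ?case
      by (simp only:)
  qed
  have "?P A"
  proof (rule induct_matrix_elementary)
    show "?P A" if "row i A = 0" for A :: "real^'m^'m" and i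
      using det_zero_row(1) [OF that] by simp
    show "?P A" if "\<And>i j. i \<noteq> j \<Longrightarrow> A$i$j = 0" for A :: "real^'m^'m"
    proof
      assume "det A \<noteq> 0"
      then have "A $ i $ i \<noteq> 0" for i
        using det_diagonal [of A] that by auto
      then have "?P (D (\<lambda>i. if i \<in> UNIV then A $ i $ i else 1))"
        by (rule diag)
      moreover have "D (\<lambda>i. if i \<in> UNIV then A $ i $ i else 1) = A"
        using that by (auto simp: D_def vec_eq_iff)
      ultimately show "gl_connected (mat 1) A \<or> gl_connected ?R A"
        using \<open>det A \<noteq> 0\<close> by simp
    qed
    \<comment> \<open>Swapping two coordinates is the reflection with normal vector
      \<open>axis m 1 - axis n 1\<close>, whose coordinate \<open>m\<close> is positive.\<close>
    show "?P (\<chi> i j. mat 1 $ i $ Transposition.transpose m n j)" if "m \<noteq> n" for m n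
    proof -
      have "gl_connected ?R (householder (axis m 1 - axis n 1))"
        by (rule gl_connected_householder_axis) (use that in \<open>auto intro!: exI [of _ m] simp: axis_def\<close>)
      moreover have "householder (axis m 1 - axis n 1) = (\<chi> i j. mat 1 $ i $ Transposition.transpose m n j)"
        using that unfolding vec_eq_iff
        by (auto simp: householder_def inner_diff inner_axis_axis mat_def Transposition.transpose_def) (auto simp: axis_def)
      ultimately show ?thesis by simp
    qed
    \<comment> \<open>Scaling the off-diagonal entry from 0 to \<open>c\<close> keeps the
      determinant equal to 1.\<close>
    show "?P (\<chi> i j. if i = m \<and> j = n then c else of_bool (i = j))" if "m \<noteq> n" for m n c
    proof -
      let ?E = "\<lambda>c. \<chi> i j. if i = m \<and> j = n then c else of_bool (i = j) :: real^'m^'m"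
      have E: "?E c = (\<chi> k. if k = m then row m (mat 1) + c *s row n (mat 1) else row k (mat 1))" for c
        using that by (auto simp: vec_eq_iff row_def mat_def)
      have "gl_connected (mat 1) (?E c)"
      proof (rule gl_connectedI [where g = "\<lambda>t. ?E (t * c)"])
        show "det (?E (t * c)) \<noteq> 0" for t
          using det_row_operation [OF that, of "mat 1" "t * c"] unfolding E [symmetric] by simp
        show "continuous_on {0..1} (\<lambda>t. ?E (t * c) $ i $ j)" for i j
          by (cases "i = m \<and> j = n") (auto intro!: continuous_intros)
      qed (use that in \<open>auto simp: vec_eq_iff mat_def\<close>)
      then show ?thesis by (intro impI disjI1)
    qed
  qed (rule mult)
  then show ?thesis using assms by (rule mp)
qed



section \<open>Homotopy classes of linear maps on the sphere\<close>

text \<open>The homotopy is carried over to \<open>nsphere p\<close>, where the identity has Brouwer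
  degree 1 and the reflection has degree -1.\<close>

lemma reflection_not_homotopic_id:
  fixes k :: "'m::finite"
  assumes "homotopic_with_canon (\<lambda>_. True) (sphere 0 1) (- {0}) id ((*v) (householder (axis k 1)))"
  shows False
proof -
  let ?R = "householder (axis k 1) :: real^'m^'m"
  define n where "n = CARD('m)"
  \<comment> \<open>The sphere \<open>nsphere p\<close> lives in \<open>p + 1\<close>
    coordinates.\<close>
  define p where "p = n - 1"
  have n: "0 < n" "n = Suc p"
    by (simp_all add: n_def p_def)
  obtain e0 where e0: "bij_betw e0 {0..<n} (UNIV :: 'm set)"
    unfolding n_def using ex_bij_betw_nat_finite [of "UNIV :: 'm set"] by auto
  \<comment> \<open>The transposition gives \<open>k\<close> the index 0, the coordinate negated by
    the reflection whose degree is known.\<close>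
  define e where "e = Transposition.transpose (e0 0) k \<circ> e0"
  have e: "bij_betw e {..<n} UNIV"
    unfolding e_def lessThan_atLeast0 by (rule bij_betw_trans [OF e0]) (rule bij_transpose)
  have e_0: "e 0 = k"
    by (simp add: e_def)
  define e' where "e' = inv_into {..<n} e"
  have e': "bij_betw e' UNIV {..<n}"
    unfolding e'_def by (rule bij_betw_inv_into [OF e])
  have e'_e: "e' (e j) = j" if "j < n" for j
    using bij_betw_inv_into_left [OF e] that by (simp add: e'_def)
  have top: "topspace (nsphere p) = {x. (\<Sum>i<n. (x i)\<^sup>2) = 1 \<and> (\<forall>i\<ge>n. x i = 0)}"
    unfolding nsphere n(2) by (simp add: lessThan_Suc_atMost Suc_le_eq)
  \<comment> \<open>\<open>\<phi>\<close> reads a point of \<open>nsphere p\<close> as a vector, and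
    \<open>\<psi>\<close> goes back. Dividing by the norm makes \<open>\<psi>\<close> continuous on
    all of \<open>- {0}\<close>, where the homotopy takes its values.\<close>
  define \<phi> where "\<phi> x = (\<chi> i. x (e' i))" for x :: "nat \<Rightarrow> real"
  define \<psi> where "\<psi> v = (\<lambda>j. if j < n then v $ e j / norm v else 0)" for v :: "real^'m"
  have norm_vec: "(norm v)\<^sup>2 = (\<Sum>j<n. (v $ e j)\<^sup>2)" for v :: "real^'m"
    unfolding power2_norm_eq_inner inner_vec_def
    by (subst sum.reindex_bij_betw [OF e, symmetric]) (simp add: power2_eq_square)
  have norm_\<phi>: "norm (\<phi> x) = 1" if "x \<in> topspace (nsphere p)" for x
  proof -
    have "(norm (\<phi> x))\<^sup>2 = (\<Sum>j<n. (x j)\<^sup>2)"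
      by (simp add: norm_vec \<phi>_def e'_e)
    with that show ?thesis
      by (simp add: top power2_eq_1_iff) (metis norm_ge_zero not_one_le_zero neg_0_le_iff_le)
  qed
  have \<phi>: "continuous_map (nsphere p) (top_of_set (sphere 0 1)) \<phi>"
    unfolding continuous_map_in_subtopology
  proof
    have "\<phi> = (\<lambda>x. \<Sum>i\<in>UNIV. x (e' i) *\<^sub>R axis i 1)"
      by (simp add: fun_eq_iff vec_eq_iff \<phi>_def axis_def if_distrib cong: if_cong)
    moreover have "continuous_map (nsphere p) euclidean (\<lambda>x. \<Sum>i\<in>UNIV. x (e' i) *\<^sub>R axis i 1 :: real^'m)"
    proof (intro continuous_map_sum)
      fix i :: 'm
      have "continuous_map euclideanreal euclidean (\<lambda>r. r *\<^sub>R axis i 1 :: real^'m)"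
        by (simp add: continuous_intros)
      from continuous_map_compose [OF continuous_map_nsphere_projection [of p "e' i"] this]
      show "continuous_map (nsphere p) euclidean (\<lambda>x. x (e' i) *\<^sub>R axis i 1 :: real^'m)"
        by (simp add: o_def)
    qed simp
    ultimately show "continuous_map (nsphere p) euclidean \<phi>"
      by simp
  qed (use norm_\<phi> in auto)
  have \<psi>: "continuous_map (top_of_set (- {0})) (nsphere p) \<psi>"
    unfolding nsphere continuous_map_in_subtopology continuous_map_componentwise_UNIV
  proof (intro conjI allI)
    show "continuous_map (top_of_set (- {0})) euclideanreal (\<lambda>v. \<psi> v j)" for j
      by (cases "j < n") (auto simp: \<psi>_def intro!: continuous_intros)
    have "(\<Sum>j\<le>p. (\<psi> v j)\<^sup>2) = 1" if "v \<noteq> 0" for v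
    proof -
      have "(\<Sum>j\<le>p. (\<psi> v j)\<^sup>2) = (\<Sum>j<n. (v $ e j)\<^sup>2) / (norm v)\<^sup>2"
        unfolding n(2) lessThan_Suc_atMost sum_divide_distrib
        by (intro sum.cong) (auto simp: \<psi>_def n(2) power_divide)
      then show ?thesis
        using that by (simp flip: norm_vec)
    qed
    then show "\<psi> \<in> topspace (top_of_set (- {0})) \<rightarrow> {x. (\<Sum>i\<le>p. (x i)\<^sup>2) = 1 \<and> (\<forall>i>p. x i = 0)}"
      by (auto simp: \<psi>_def n(2))
  qed
  have "homotopic_with (\<lambda>_. True) (nsphere p) (nsphere p) (\<psi> \<circ> (id \<circ> \<phi>)) (\<psi> \<circ> ((*v) ?R \<circ> \<phi>))"
    by (rule homotopic_with_compose_continuous_map_left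
          [OF homotopic_with_compose_continuous_map_right [OF assms \<phi>, where q = "\<lambda>_. True"] \<psi>]) simp_all
  then have "Brouwer_degree2 p (\<psi> \<circ> (id \<circ> \<phi>)) = Brouwer_degree2 p (\<psi> \<circ> ((*v) ?R \<circ> \<phi>))"
    by (rule Brouwer_degree2_homotopic)
  also have "Brouwer_degree2 p (\<psi> \<circ> (id \<circ> \<phi>)) = Brouwer_degree2 p id"
  proof (rule Brouwer_degree2_eq)
    fix x
    assume x: "x \<in> topspace (nsphere p)"
    then show "(\<psi> \<circ> (id \<circ> \<phi>)) x = id x"
      using norm_\<phi> [OF x] by (auto simp: \<psi>_def \<phi>_def e'_e top)
  qed
  also have "Brouwer_degree2 p (\<psi> \<circ> ((*v) ?R \<circ> \<phi>)) = Brouwer_degree2 p (\<lambda>x i. if i = 0 then - x i else x i)"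
  proof (rule Brouwer_degree2_eq)
    fix x
    assume x: "x \<in> topspace (nsphere p)"
    have R: "?R *v v = (\<chi> i. if i = k then - v $ i else v $ i)" for v
      by (simp add: householder_axis matrix_vector_mult_def vec_eq_iff if_distrib [of "\<lambda>x. x * y" for y] cong: if_cong)
    have "norm (?R *v v) = norm v" for v
      by (auto simp: R norm_eq_sqrt_inner inner_vec_def intro!: sum.cong)
    moreover have "e j = k \<longleftrightarrow> j = 0" if "j < n" for j
      using e'_e that n(1) e_0 by metis
    ultimately show "(\<psi> \<circ> ((*v) ?R \<circ> \<phi>)) x = (\<lambda>i. if i = 0 then - x i else x i)"
      using norm_\<phi> [OF x] x by (auto simp: \<psi>_def R \<phi>_def e'_e top)
  qed
  finally show False
    by (simp add: Brouwer_degree2_reflection)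
qed

text \<open>Invertible matrices send no unit vector to 0, so a path of them acts as a homotopy into
  \<open>- {0}\<close>.\<close>

lemma gl_connected_imp_homotopic:
  fixes A B :: "real^'m^'m"
  assumes "gl_connected A B"
  shows "homotopic_with_canon (\<lambda>_. True) (sphere 0 1) (- {0}) ((*v) A) ((*v) B)"
proof -
  obtain g :: "real \<Rightarrow> real^'m^'m"
    where g: "continuous_on {0..1} g" "\<And>t. t \<in> {0..1} \<Longrightarrow> det (g t) \<noteq> 0" "g 0 = A" "g 1 = B"
    by (rule gl_connectedE [OF assms]) (rule that)
  have nz: "g t *v v \<noteq> 0" if "0 \<le> t" "t \<le> 1" "norm v = 1" for t v
    using g(2) [of t] that
    by (metis atLeastAtMost_iff invertible_det_nz invertible_left_inverse matrix_left_invertible_ker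
        norm_zero zero_neq_one)
  have "continuous_on ({0..1} \<times> sphere 0 1) (\<lambda>z. g (fst z) *v snd z)"
  proof -
    have "continuous_on ({0..1} \<times> sphere 0 1) (\<lambda>z :: real \<times> (real^'m). g (fst z))"
      by (rule continuous_on_compose2 [OF g(1)]) (auto intro!: continuous_intros)
    then show ?thesis
      unfolding matrix_vector_mult_def by (intro continuous_intros)
  qed
  then show ?thesis
    unfolding homotopic_with_def
    by (intro exI [of _ "\<lambda>z. g (fst z) *v snd z"]) (auto simp: g nz)
qed

text \<open>Along the path the determinant is continuous without zeros, so the intermediate value
  theorem forbids a change of sign.\<close>

lemma gl_connected_det_pos:
  fixes A B :: "real^'m^'m"
  assumes "gl_connected A B" "0 < det A"
  shows "0 < det B"
proof (rule ccontr)
  assume B: "\<not> 0 < det B"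
  obtain g :: "real \<Rightarrow> real^'m^'m"
    where g: "continuous_on {0..1} g" "\<And>t. t \<in> {0..1} \<Longrightarrow> det (g t) \<noteq> 0" "g 0 = A" "g 1 = B"
    by (rule gl_connectedE [OF assms(1)]) (rule that)
  have "continuous_on {0..1} (\<lambda>t. det (g t))"
    unfolding det_def by (intro continuous_intros g)
  then obtain t where "0 \<le> t" "t \<le> 1" "det (g t) = 0"
    using IVT2' [of "\<lambda>t. det (g t)" 1 0 0] g B assms(2) by auto
  with g(2) [of t] show False by simp
qed

text \<open>The sign of the determinant excludes the component of the identity. By the dichotomy
  \<open>A\<close> is joined to a reflection, which would then be homotopic to the identity.\<close>

lemma negative_det_not_homotopic_id:
  fixes A :: "real^'m^'m"
  assumes "det A < 0"
  shows "\<not> homotopic_with_canon (\<lambda>_. True) (sphere 0 1) (- {0}) id ((*v) A)"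
proof
  fix k :: 'm
  assume hom: "homotopic_with_canon (\<lambda>_. True) (sphere 0 1) (- {0}) id ((*v) A)"
  have "\<not> gl_connected (mat 1) A"
    using gl_connected_det_pos [of "mat 1" A] assms by auto
  then have "gl_connected (householder (axis k 1)) A"
    using gl_connected_dichotomy [of A k] assms by auto
  then have "homotopic_with_canon (\<lambda>_. True) (sphere 0 1) (- {0}) ((*v) (householder (axis k 1))) ((*v) A)"
    by (rule gl_connected_imp_homotopic)
  from homotopic_with_trans [OF hom homotopic_with_symD [OF this]] show False
    by (rule reflection_not_homotopic_id)
qed

section \<open>The Cauchy-Binet formula and the sign of weighted sums of rank-one matrices\<close>

text \<open>The sum runs over all functions, so every pair of minors is counted \<open>CARD('m)!\<close> times.\<close>

lemma Cauchy_Binet_functions: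
  fixes a b :: "'i \<Rightarrow> real^'m" and c :: "'i \<Rightarrow> real"
  assumes "finite T"
  shows "fact CARD('m) * det (\<chi> i j. \<Sum>t\<in>T. c t * a t $ i * b t $ j) =
    (\<Sum>g | range g \<subseteq> T. (\<Prod>i\<in>UNIV. c (g i)) * (det (\<chi> i. a (g i)) * det (\<chi> i. b (g i))))"
proof -
  let ?M = "\<chi> i j. \<Sum>t\<in>T. c t * a t $ i * b t $ j"
  let ?F = "{g :: 'm \<Rightarrow> 'i. range g \<subseteq> T}"
  let ?S = "{p. p permutes (UNIV :: 'm set)}"
  let ?c = "\<lambda>g. \<Prod>i\<in>UNIV. c (g i)"
  have F: "PiE UNIV (\<lambda>_. T) = ?F"
    by (auto simp: PiE_def)
  \<comment> \<open>The Leibniz formula is expanded over all choices \<open>g\<close> of one summand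
    per row; the sum over permutations then collects into the determinant of the
    \<open>b (g i)\<close>.\<close>
  have det: "det ?M = (\<Sum>g\<in>?F. ?c g * (\<Prod>i\<in>UNIV. a (g i) $ i) * det (\<chi> i. b (g i)))"
  proof -
    have "det ?M = (\<Sum>p\<in>?S. of_int (sign p) * (\<Prod>i\<in>UNIV. \<Sum>t\<in>T. c t * a t $ i * b t $ p i))"
      by (simp add: det_def)
    also have "\<dots> = (\<Sum>p\<in>?S. \<Sum>g\<in>?F. of_int (sign p) * (\<Prod>i\<in>UNIV. c (g i) * a (g i) $ i * b (g i) $ p i))"
      using assms by (simp add: prod_sum_PiE flip: F sum_distrib_left)
    also have "\<dots> = (\<Sum>g\<in>?F. \<Sum>p\<in>?S. of_int (sign p) * (\<Prod>i\<in>UNIV. c (g i) * a (g i) $ i * b (g i) $ p i))"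
      by (rule sum.swap)
    also have "\<dots> = (\<Sum>g\<in>?F. ?c g * (\<Prod>i\<in>UNIV. a (g i) $ i) * det (\<chi> i. b (g i)))"
      by (simp only: det_def prod.distrib sum_distrib_left vec_lambda_beta ac_simps)
    finally show ?thesis .
  qed
  \<comment> \<open>Reindexing by \<open>g \<circ> p\<close> leaves the weights unchanged and
    changes the determinant of the \<open>b\<close> rows by \<open>sign p\<close>. Summing over all
    \<open>p\<close> then builds the determinant of the \<open>a\<close> rows as well.\<close>
  have perm: "det ?M = (\<Sum>g\<in>?F. ?c g * (of_int (sign p) * (\<Prod>i\<in>UNIV. a (g (p i)) $ i)) * det (\<chi> i. b (g i)))"
    if p: "p permutes UNIV" for p
  proof -
    have bij: "bij_betw (\<lambda>g. g \<circ> p) ?F ?F"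
      by (rule bij_betw_byWitness [where f' = "\<lambda>g. g \<circ> inv_into UNIV p"])
        (use permutes_inv_o [OF p] in \<open>auto simp: o_assoc [symmetric]\<close>)
    have "det ?M = (\<Sum>g\<in>?F. ?c (g \<circ> p) * (\<Prod>i\<in>UNIV. a ((g \<circ> p) i) $ i) * det (\<chi> i. b ((g \<circ> p) i)))"
      unfolding det by (rule sum.reindex_bij_betw [OF bij, symmetric])
    also have "\<dots> = (\<Sum>g\<in>?F. ?c g * (of_int (sign p) * (\<Prod>i\<in>UNIV. a (g (p i)) $ i)) * det (\<chi> i. b (g i)))"
    proof (intro sum.cong refl)
      fix g :: "'m \<Rightarrow> 'i"
      have "?c (g \<circ> p) = ?c g"
        using prod.permute [OF p, of "\<lambda>i. c (g i)"] by (simp add: o_def)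
      moreover have "det (\<chi> i. b ((g \<circ> p) i)) = of_int (sign p) * det (\<chi> i. b (g i))"
        using det_permute_rows [OF p, of "\<chi> i. b (g i)"] by simp
      ultimately show "?c (g \<circ> p) * (\<Prod>i\<in>UNIV. a ((g \<circ> p) i) $ i) * det (\<chi> i. b ((g \<circ> p) i))
        = ?c g * (of_int (sign p) * (\<Prod>i\<in>UNIV. a (g (p i)) $ i)) * det (\<chi> i. b (g i))"
        by simp
    qed
    finally show ?thesis .
  qed
  have "fact CARD('m) * det ?M = (\<Sum>p\<in>?S. det ?M)"
    by (simp add: card_permutations)
  also have "\<dots> = (\<Sum>p\<in>?S. \<Sum>g\<in>?F. ?c g * (of_int (sign p) * (\<Prod>i\<in>UNIV. a (g (p i)) $ i)) * det (\<chi> i. b (g i)))"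
    by (rule sum.cong [OF refl], rule perm) simp
  also have "\<dots> = (\<Sum>g\<in>?F. \<Sum>p\<in>?S. ?c g * (of_int (sign p) * (\<Prod>i\<in>UNIV. a (g (p i)) $ i)) * det (\<chi> i. b (g i)))"
    by (rule sum.swap)
  also have "\<dots> = (\<Sum>g\<in>?F. ?c g * (det (\<chi> i. a (g i)) * det (\<chi> i. b (g i))))"
  proof (intro sum.cong refl)
    fix g :: "'m \<Rightarrow> 'i"
    have "det (\<chi> i. a (g i)) = (\<Sum>p\<in>?S. of_int (sign p) * (\<Prod>i\<in>UNIV. a (g (p i)) $ i))"
      by (subst det_transpose [symmetric]) (simp add: det_def transpose_def)
    then show "(\<Sum>p\<in>?S. ?c g * (of_int (sign p) * (\<Prod>i\<in>UNIV. a (g (p i)) $ i)) * det (\<chi> i. b (g i)))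
        = ?c g * (det (\<chi> i. a (g i)) * det (\<chi> i. b (g i)))"
      by (simp only: sum_distrib_left sum_distrib_right mult.assoc)
  qed
  finally show ?thesis .
qed

text \<open>In the Cauchy-Binet sum, injective choices contribute negative terms and all others
  vanish because of a repeated row. The bound on \<open>card T\<close> provides at least one
  injective choice.\<close>

lemma det_weighted_gram_negative:
  fixes a b :: "'i \<Rightarrow> real^'m" and c :: "'i \<Rightarrow> real"
  assumes T: "finite T" "CARD('m) \<le> card T"
    and c: "\<And>t. t \<in> T \<Longrightarrow> 0 < c t"
    and neg: "\<And>g. \<lbrakk>inj g; range g \<subseteq> T\<rbrakk> \<Longrightarrow> det (\<chi> i. a (g i)) * det (\<chi> i. b (g i)) < 0"
  shows "det (\<chi> i j. \<Sum>t\<in>T. c t * a t $ i * b t $ j) < 0"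
proof -
  let ?F = "{g :: 'm \<Rightarrow> 'i. range g \<subseteq> T}"
  let ?term = "\<lambda>g. (\<Prod>i\<in>UNIV. c (g i)) * (det (\<chi> i. a (g i)) * det (\<chi> i. b (g i)))"
  have pos: "(\<Prod>i\<in>UNIV. c (g i)) > 0" if "range g \<subseteq> T" for g :: "'m \<Rightarrow> 'i"
    by (intro prod_pos ballI c) (use that in auto)
  have inj: "?term g < 0" if "g \<in> ?F" "inj g" for g
    by (rule mult_pos_neg [OF pos neg]) (use that in auto)
  have not_inj: "?term g = 0" if ninj: "\<not> inj g" for g
  proof -
    obtain i j where "i \<noteq> j" "g i = g j"
      using ninj by (auto simp: inj_on_def)
    then have "det (\<chi> i. a (g i)) = 0"
      by (intro det_identical_rows [of i j]) (auto simp: row_def)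
    then show ?thesis by simp
  qed
  obtain f :: "'m \<Rightarrow> 'i" where f: "inj f" "range f \<subseteq> T"
    using card_le_inj [of "UNIV :: 'm set" T] T by auto
  have "?F = PiE UNIV (\<lambda>_. T)"
    by (auto simp: PiE_def)
  then have "finite ?F"
    using T by (simp add: finite_PiE)
  moreover have "\<forall>g\<in>?F. ?term g \<le> 0"
    using inj not_inj by (metis less_imp_le order_refl)
  moreover have "\<exists>g\<in>?F. ?term g < 0"
    using inj [of f] f by blast
  ultimately have "(\<Sum>g\<in>?F. ?term g) < (\<Sum>g\<in>?F. 0)"
    by (rule sum_strict_mono_ex1)
  then have "fact CARD('m) * det (\<chi> i j. \<Sum>t\<in>T. c t * a t $ i * b t $ j) < 0"
    unfolding Cauchy_Binet_functions [OF T(1)] by simp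
  then show ?thesis
    by (simp add: mult_less_0_iff)
qed

section \<open>Existence of the separating vector\<close>

text \<open>By contradiction, two straight-line homotopies in \<open>- {0}\<close> join the identity
  to a linear map of negative determinant. The weights have to depend continuously on
  \<open>v\<close> and stay positive.\<close>

lemma exists_separating_vector_finite:
  fixes a b :: "'i \<Rightarrow> real^'m"
  assumes T: "finite T" "CARD('m) \<le> card T"
    and neg: "\<And>g. \<lbrakk>inj g; range g \<subseteq> T\<rbrakk> \<Longrightarrow> det (\<chi> i. a (g i)) * det (\<chi> i. b (g i)) < 0"
  shows "\<exists>v\<in>sphere 0 1. \<forall>t\<in>T. (a t \<bullet> v) * (b t \<bullet> v) \<le> 0"
proof (rule ccontr)
  assume "\<not> (\<exists>v\<in>sphere 0 1. \<forall>t\<in>T. (a t \<bullet> v) * (b t \<bullet> v) \<le> 0)"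
  then have ex: "\<exists>t\<in>T. 0 < (a t \<bullet> v) * (b t \<bullet> v)" if "norm v = 1" for v
    using that by (force simp: not_le)
  define Q where "Q t v = (a t \<bullet> v) * (b t \<bullet> v)" for t v
  define M where "M c = (\<chi> i j. \<Sum>t\<in>T. c t * a t $ i * b t $ j)" for c
  have M: "M c *v v = (\<Sum>t\<in>T. (c t * (b t \<bullet> v)) *\<^sub>R a t)" for c v
  proof -
    have "(\<Sum>j\<in>UNIV. \<Sum>t\<in>T. c t * a t $ i * b t $ j * v $ j) = (\<Sum>t\<in>T. c t * (b t \<bullet> v) * a t $ i)" for i
      by (subst sum.swap) (simp add: inner_vec_def sum_distrib_left sum_distrib_right mult_ac)
    then show ?thesis
      by (simp add: M_def matrix_vector_mult_def vec_eq_iff sum_distrib_right)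
  qed
  define P where "P v = (\<Sum>t\<in>T. (max 0 (Q t v))\<^sup>2)" for v
  \<comment> \<open>The summand besides \<open>max 0 (Q t v)\<close> makes all weights positive and is too small to affect the
    sign of \<open>v \<bullet> (M (c v) *v v)\<close>.\<close>
  define c where "c v t = max 0 (Q t v) + P v / (1 + \<bar>\<Sum>t\<in>T. Q t v\<bar>)" for v t
  have P: "0 < P v" if v: "norm v = 1" for v
  proof -
    obtain t where "t \<in> T" "0 < Q t v"
      using ex [OF v] by (auto simp: Q_def)
    then show ?thesis
      unfolding P_def by (intro sum_pos2 [of T t]) (use T in auto)
  qed
  have c: "0 < c v t" if "norm v = 1" for v t
    unfolding c_def by (rule add_nonneg_pos [OF _ divide_pos_pos [OF P [OF that]]]) (simp_all add: add_pos_nonneg)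
  have inner: "0 < v \<bullet> (M (c v) *v v)" if v: "norm v = 1" for v
  proof -
    let ?S = "\<Sum>t\<in>T. Q t v"
    have "v \<bullet> (M (c v) *v v) = (\<Sum>t\<in>T. c v t * Q t v)"
      by (simp add: M Q_def inner_sum_right inner_commute mult_ac)
    also have "\<dots> = (\<Sum>t\<in>T. (max 0 (Q t v))\<^sup>2 + P v / (1 + \<bar>?S\<bar>) * Q t v)"
      by (intro sum.cong) (auto simp: c_def max_def power2_eq_square algebra_simps)
    \<comment> \<open>The positive parts contribute \<open>P v\<close>; the correction exceeds
      \<open>- P v\<close> because \<open>?S\<close> is divided by
      \<open>1 + \<bar>?S\<bar>\<close>.\<close>
    also have "\<dots> = P v + P v / (1 + \<bar>?S\<bar>) * ?S"
      by (simp only: sum.distrib P_def [of v, symmetric] sum_distrib_left [symmetric])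
    also have "\<dots> = P v * (1 + \<bar>?S\<bar> + ?S) / (1 + \<bar>?S\<bar>)"
      by (simp add: field_simps)
    also have "\<dots> > 0"
      by (intro divide_pos_pos mult_pos_pos P v) (simp_all add: add_pos_nonneg)
    finally show ?thesis .
  qed
  have M_nz: "M w *v v \<noteq> 0" if "norm v = 1" "\<And>t. 0 < w t" for w v
  proof -
    have "det (M w) < 0"
      unfolding M_def by (intro det_weighted_gram_negative T that neg)
    with that(1) show ?thesis
      by (metis invertible_det_nz invertible_left_inverse less_irrefl matrix_left_invertible_ker
          norm_zero zero_neq_one)
  qed
  have cont_Q: "continuous_on (sphere 0 1) (Q t)" for t
    unfolding Q_def by (intro continuous_intros)
  have cont_c: "continuous_on (sphere 0 1) (\<lambda>v. c v t)" for t
    unfolding c_def P_def by (intro continuous_intros cont_Q) auto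
  have cont: "continuous_on (sphere 0 1) (\<lambda>v. M (c v) *v v)"
    unfolding M by (intro continuous_intros cont_c)
  have "homotopic_with_canon (\<lambda>_. True) (sphere 0 1) (- {0}) id (\<lambda>v. M (c v) *v v)"
  proof (rule homotopic_with_linear [OF _ cont])
    fix v :: "real^'m"
    assume "v \<in> sphere 0 1"
    then have v: "norm v = 1" by simp
    show "closed_segment (id v) (M (c v) *v v) \<subseteq> - {0}"
    proof
      fix z
      assume "z \<in> closed_segment (id v) (M (c v) *v v)"
      then obtain u where u: "0 \<le> u" "u \<le> 1" "z = (1 - u) *\<^sub>R v + u *\<^sub>R (M (c v) *v v)"
        by (auto simp: closed_segment_def)
      \<comment> \<open>Both endpoints have positive inner product with \<open>v\<close>, hence so
        does the whole segment.\<close>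
      have "v \<bullet> z = (1 - u) * 1 + u * (v \<bullet> (M (c v) *v v))"
        using v by (simp add: u(3) inner_add_right norm_eq_1)
      also have "\<dots> > 0"
      proof (cases "u = 0")
        case False
        then have "0 < u * (v \<bullet> (M (c v) *v v))"
          using u inner [OF v] by simp
        with u show ?thesis by (intro add_nonneg_pos) simp_all
      qed simp
      finally show "z \<in> - {0}" by auto
    qed
  qed (simp add: continuous_on_id)
  moreover have "homotopic_with_canon (\<lambda>_. True) (sphere 0 1) (- {0}) (\<lambda>v. M (c v) *v v) ((*v) (M (\<lambda>_. 1)))"
  proof (rule homotopic_with_linear [OF cont])
    fix v :: "real^'m"
    assume "v \<in> sphere 0 1"
    then have v: "norm v = 1" by simp
    show "closed_segment (M (c v) *v v) (M (\<lambda>_. 1) *v v) \<subseteq> - {0}"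
    proof
      fix z
      assume "z \<in> closed_segment (M (c v) *v v) (M (\<lambda>_. 1) *v v)"
      then obtain u where u: "0 \<le> u" "u \<le> 1" "z = (1 - u) *\<^sub>R (M (c v) *v v) + u *\<^sub>R (M (\<lambda>_. 1) *v v)"
        by (auto simp: closed_segment_def)
      \<comment> \<open>Since \<open>M\<close> is linear in the weights, a point of the segment
        belongs to the interpolated weights, which are again positive.\<close>
      have "z = M (\<lambda>t. (1 - u) * c v t + u) *v v"
        unfolding u(3) M scaleR_sum_right sum.distrib [symmetric]
        by (intro sum.cong refl) (simp add: algebra_simps)
      moreover have "0 < (1 - u) * c v t + u" for t
        using u c [OF v, of t] by (cases "u = 0") (auto intro: add_nonneg_pos)
      ultimately show "z \<in> - {0}"
        using M_nz [OF v] by simp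
    qed
  qed (intro continuous_intros)
  ultimately have "homotopic_with_canon (\<lambda>_. True) (sphere 0 1) (- {0}) id ((*v) (M (\<lambda>_. 1)))"
    by (rule homotopic_with_trans)
  moreover have "det (M (\<lambda>_. 1)) < 0"
    unfolding M_def by (intro det_weighted_gram_negative T neg) simp
  ultimately show False
    using negative_det_not_homotopic_id by blast
qed

text \<open>Each \<open>t\<close> imposes a closed condition on the compact unit sphere, so the
  finite intersection property reduces the claim to finite sets.\<close>

lemma exists_separating_vector:
  fixes a b :: "'i \<Rightarrow> real^'m"
  assumes "infinite I"
    and neg: "\<And>g. \<lbrakk>inj g; range g \<subseteq> I\<rbrakk> \<Longrightarrow> det (\<chi> i. a (g i)) * det (\<chi> i. b (g i)) < 0"
  shows "\<exists>v\<in>sphere 0 1. \<forall>t\<in>I. (a t \<bullet> v) * (b t \<bullet> v) \<le> 0"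
proof -
  \<comment> \<open>\<open>B\<close> is added to every finite set in order to reach the cardinality
    that the finite case demands.\<close>
  obtain B where B: "B \<subseteq> I" "finite B" "card B = CARD('m)"
    using infinite_arbitrarily_large [OF assms(1)] by metis
  have "sphere 0 1 \<inter> (\<Inter>t\<in>I. {v. (a t \<bullet> v) * (b t \<bullet> v) \<le> 0}) \<noteq> {}"
  proof (rule compact_imp_fip_image)
    show "closed {v. (a t \<bullet> v) * (b t \<bullet> v) \<le> 0}" for t
      by (intro closed_Collect_le continuous_intros)
    fix T
    assume T: "finite T" "T \<subseteq> I"
    have "\<exists>v\<in>sphere 0 1. \<forall>t\<in>T \<union> B. (a t \<bullet> v) * (b t \<bullet> v) \<le> 0"
    proof (rule exists_separating_vector_finite)
      show "CARD('m) \<le> card (T \<union> B)"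
        using B T card_mono [of "T \<union> B" B] by simp
      show "det (\<chi> i. a (g i)) * det (\<chi> i. b (g i)) < 0" if "inj g" "range g \<subseteq> T \<union> B" for g
        using that B T by (intro neg) auto
    qed (use T B in auto)
    then show "sphere 0 1 \<inter> (\<Inter>t\<in>T. {v. (a t \<bullet> v) * (b t \<bullet> v) \<le> 0}) \<noteq> {}"
      by fastforce
  qed simp
  then show ?thesis by auto
qed

section \<open>Orientation determinants in homogeneous coordinates\<close>

text \<open>The layout is that of a column of \<open>orientation_matrix\<close>: column
  \<open>j\<close> is \<open>homogenize (C (t (position j)))\<close>.\<close>

definition homogenize :: "real^'n \<Rightarrow> real^('n option)" where
  "homogenize x = (\<chi> i. case i of Some k \<Rightarrow> x $ k | None \<Rightarrow> 1)"

lemma inner_homogenize: "homogenize x \<bullet> v = (\<chi> k. v $ Some k) \<bullet> x + v $ None"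
  by (simp add: inner_vec_def homogenize_def UNIV_option_conv sum.reindex mult.commute)

text \<open>\<open>card {..<k}\<close> is the rank of \<open>k\<close>, strictly increasing and
  below \<open>CARD('n)\<close>, the value at \<open>None\<close>. Injectivity and a count of
  elements give the bijection.\<close>

lemma bij_betw_position: "bij_betw position (UNIV :: 'n::{finite,linorder} option set) {0..CARD('n)}"
proof -
  have less: "card {..<k} < CARD('n)" for k :: 'n
    by (rule psubset_card_mono) auto
  have mono: "card {..<k} < card {..<l}" if "k < l" for k l :: 'n
    by (rule psubset_card_mono) (use that in auto)
  then have inj: "k = l" if "card {..<k} = card {..<l}" for k l :: 'n
    using that by (metis less_irrefl linorder_neqE)
  have "inj (position :: 'n option \<Rightarrow> nat)"
  proof (rule injI)
    fix i j :: "'n option"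
    assume "position i = position j"
    then show "i = j"
      using less_imp_neq [OF less] less_imp_neq [OF less, symmetric]
      by (cases i; cases j) (auto simp: position_def dest: inj)
  qed
  moreover have "range (position :: 'n option \<Rightarrow> nat) \<subseteq> {0..CARD('n)}"
    using less by (auto simp: position_def less_imp_le split: option.splits)
  ultimately show ?thesis
    unfolding bij_betw_def by (intro conjI card_subset_eq) (simp_all add: card_image)
qed

text \<open>Sorting the parameters permutes the rows of both matrices in the same way, so the sign
  of the permutation cancels in the product.\<close>

lemma det_homogenize_neg:
  fixes C1 C2 :: "real \<Rightarrow> real^('n::{finite,linorder})" and f :: "'n option \<Rightarrow> real"
  assumes opp: "opposite_orientations_on I C1 C2" and f: "inj f" "range f \<subseteq> I"
  shows "det (\<chi> i. homogenize (C1 (f i))) * det (\<chi> i. homogenize (C2 (f i))) < 0"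
proof -
  define xs where "xs = sorted_list_of_set (range f)"
  define t where "t = (!) xs"
  have "length xs = Suc CARD('n)"
    using f(1) by (simp add: xs_def card_image)
  then have len: "{..<length xs} = {0..CARD('n)}"
    by auto
  have set: "set xs = range f"
    by (simp add: xs_def)
  have mono: "strict_mono_on {0..CARD('n)} t"
    unfolding strict_mono_on_def t_def len [symmetric]
    using strict_sorted_list_of_set [of "range f"] by (auto simp: sorted_wrt_iff_nth_less xs_def)
  have bij_t: "bij_betw t {0..CARD('n)} (range f)"
    unfolding t_def by (rule bij_betw_nth) (simp_all add: len set, simp add: xs_def)
  define h :: "'n option \<Rightarrow> real" where "h = t \<circ> position"
  have h: "bij_betw h UNIV (range f)"
    unfolding h_def by (rule bij_betw_trans [OF bij_betw_position bij_t])
  define p where "p = inv_into UNIV h \<circ> f"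
  have "bij p"
    unfolding p_def by (rule bij_betw_trans [OF _ bij_betw_inv_into [OF h]]) (use f in \<open>simp add: bij_betw_def\<close>)
  then have p: "p permutes UNIV"
    by (simp add: permutes_def bij_iff)
  have f_eq: "f i = h (p i)" for i
    unfolding p_def o_def by (rule bij_betw_inv_into_right [OF h, symmetric]) simp
  have det: "det (\<chi> i. homogenize (C (f i))) = of_int (sign p) * det (orientation_matrix C t)"
    for C
  proof -
    \<comment> \<open>Points are columns in \<open>orientation_matrix\<close> but rows here.\<close>
    have "orientation_matrix C t = transpose (\<chi> i. homogenize (C (h i)))"
      by (simp add: orientation_matrix_def transpose_def homogenize_def h_def)
    then show ?thesis
      using det_permute_rows [OF p, of "\<chi> i. homogenize (C (h i))"] by (simp add: f_eq)
  qed
  have "t ` {0..CARD('n)} \<subseteq> I"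
    using bij_t f(2) by (simp add: bij_betw_def)
  with mono opp have "det (orientation_matrix C1 t) * det (orientation_matrix C2 t) < 0"
    unfolding opposite_orientations_on_def positively_oriented_on_def negatively_oriented_on_def
    by (meson mult_neg_pos mult_pos_neg)
  moreover have "det (\<chi> i. homogenize (C1 (f i))) * det (\<chi> i. homogenize (C2 (f i)))
      = of_int (sign p * sign p) * (det (orientation_matrix C1 t) * det (orientation_matrix C2 t))"
    by (simp only: det of_int_mult mult_ac)
  ultimately show ?thesis
    by simp
qed

section \<open>From the separating vector to the hyperplane\<close>

lemma hyperplane_if_opposite_orientations:
  fixes C1 C2 :: "real \<Rightarrow> real ^ ('n::{finite,linorder})"
  assumes "infinite I" "opposite_orientations_on I C1 C2"
  shows "\<exists>H. hyperplane H \<and>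
           (\<forall>t\<in>I. \<forall>S. open_halfspace_of H S \<longrightarrow> \<not> (C1 t \<in> S \<and> C2 t \<in> S))"
proof -
  obtain v :: "real^('n option)" where v: "norm v = 1"
    and neg: "\<And>t. t \<in> I \<Longrightarrow> (homogenize (C1 t) \<bullet> v) * (homogenize (C2 t) \<bullet> v) \<le> 0"
    using exists_separating_vector [OF assms(1), of "\<lambda>t. homogenize (C1 t)" "\<lambda>t. homogenize (C2 t)"]
      det_homogenize_neg [OF assms(2)] by auto
  define a where "a = (\<chi> k. v $ Some k)"
  define b where "b = - v $ None"
  have neg': "(a \<bullet> C1 t - b) * (a \<bullet> C2 t - b) \<le> 0" if "t \<in> I" for t
    using neg [OF that] by (simp add: inner_homogenize a_def b_def)
  \<comment> \<open>If \<open>a\<close> were 0, the inequality at any parameter would read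
    \<open>b * b \<le> 0\<close>, forcing \<open>v = 0\<close>.\<close>
  have "a \<noteq> 0"
  proof
    assume a: "a = 0"
    obtain t where "t \<in> I"
      using assms(1) infinite_imp_nonempty by blast
    with neg' [of t] a have "v $ None = 0"
      by (auto simp: b_def mult_le_0_iff)
    moreover have "v $ Some k = 0" for k
      using a by (simp add: a_def vec_eq_iff)
    ultimately have "v = 0"
      by (auto simp: vec_eq_iff) (metis not_None_eq)
    with v show False by simp
  qed
  show ?thesis
  proof (intro exI [of _ "{x. a \<bullet> x = b}"] conjI ballI allI impI notI)
    show "hyperplane {x. a \<bullet> x = b}"
      using \<open>a \<noteq> 0\<close> by (auto simp: hyperplane_def)
    fix t S
    assume t: "t \<in> I" and S: "open_halfspace_of {x. a \<bullet> x = b} S" and C: "C1 t \<in> S \<and> C2 t \<in> S"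
    obtain a' b' where S': "{x. a \<bullet> x = b} = {x. a' \<bullet> x = b'}" "S = {x. a' \<bullet> x < b'}"
      using S by (auto simp: open_halfspace_of_def)
    \<comment> \<open>\<open>S\<close> may come from another equation \<open>(a', b')\<close> of the
      same hyperplane. Instead of comparing the equations, it is enough that \<open>S\<close> is
      connected and misses the hyperplane, so \<open>a \<bullet> x\<close> cannot pass the value
      \<open>b\<close> on \<open>S\<close>.\<close>
    then have "connected S"
      by (simp add: convex_connected convex_halfspace_lt)
    moreover have "a \<bullet> x \<noteq> b" if "x \<in> S" for x
      using S' that by (metis (mono_tags, lifting) less_irrefl mem_Collect_eq)
    moreover have "a \<bullet> C1 t \<le> b \<and> b \<le> a \<bullet> C2 t \<or> a \<bullet> C2 t \<le> b \<and> b \<le> a \<bullet> C1 t"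
      using neg' [OF t] by (auto simp: mult_le_0_iff)
    ultimately show False
      using connected_ivt_hyperplane [of S "C1 t" "C2 t" a b] connected_ivt_hyperplane [of S "C2 t" "C1 t" a b] C
      by blast
  qed
qed

theorem theorem1p1:
  fixes C1 C2 :: "real \<Rightarrow> real ^ ('n::{finite,linorder})"
  assumes "(convex_curve C1 \<and> convex_curve C2 \<and> opposite_orientations_on {0..1} C1 C2) \<or>
           (closed_convex_curve C1 \<and> closed_convex_curve C2 \<and> opposite_orientations_on {0..<1} C1 C2)"
  shows "\<exists>H. hyperplane H \<and>
           (\<forall>t\<in>{0..1}. \<forall>S. open_halfspace_of H S \<longrightarrow> \<not> (C1 t \<in> S \<and> C2 t \<in> S))"
  using assms
proof (elim disjE conjE)
  assume "opposite_orientations_on {0..1} C1 C2"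
  then show ?thesis
    by (intro hyperplane_if_opposite_orientations) simp_all
next
  assume "closed_convex_curve C1" "closed_convex_curve C2"
  then have ends: "C1 1 = C1 0" "C2 1 = C2 0"
    by (simp_all add: closed_convex_curve_def)
  assume "opposite_orientations_on {0..<1} C1 C2"
  then obtain H where "hyperplane H"
    and H: "\<And>t S. t \<in> {0..<1} \<Longrightarrow> open_halfspace_of H S \<Longrightarrow> \<not> (C1 t \<in> S \<and> C2 t \<in> S)"
    using hyperplane_if_opposite_orientations [of "{0..<1}" C1 C2] by auto
  \<comment> \<open>The parameter 1, missing from \<open>{0..<1}\<close>, is covered by 0 because
    the curves are closed.\<close>
  have "\<not> (C1 t \<in> S \<and> C2 t \<in> S)" if "t \<in> {0..1}" "open_halfspace_of H S" for t S
    using H [of t S] H [of 0 S] that ends by (cases "t = 1") auto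
  with \<open>hyperplane H\<close> show ?thesis by blast
qed

end
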